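(* Let $m,k\ge 1$ and let $A(z) = z^k 1_m - A_1 z^{k-1} - \cdots - A_k$ be a matrix polynomial with coefficients $A_1,\dots,A_k\in\mathbb{R}^{m\times m}$. Then $A(z)$ is Schur-Stable if and only if there exists a positive definite symmetric block Toeplitz matrix $\underline{U}_k$ of order $k$ with $m\times m$ blocks $U(0),U(1),\dots,U(k)$, such that the coefficients $A=[A_1,\dots,A_k]\in\mathbb{R}^{m\times mk}$ satisfy $$A = \xi_k'\,\underline{U}_{k-1}^{-1}.$$
   Context: All matrices are real; a prime denotes transpose; $1_m$ is the $m\times m$ identity matrix. A matrix polynomial $A(z)=z^k 1_m - A_1z^{k-1}-\cdots-A_k$ is called Schur-Stable if all its roots, i.e. all complex $z$ with $\det(A(z))=0$, lie in the open unit disc $\{z\in\mathbb{C}:|z|<1\}$. For $t\ge 0$, given $m\times m$ real matrices $U(0),U(1),\dots,U(t)$ with $U(0)$ symmetric, $\underline{U}_t$ denotes the symmetric block Toeplitz matrix of order $t$, of size $m(t+1)\times m(t+1)$, whose $(i,j)$ block ($1\le i,j\le t+1$) is $U(j-i)$ if $j\ge i$ and $U(i-j)'$ if $j<i$. In particular $\underline{U}_0=U(0)$. For $t\ge1$ put $\xi_t'=(U(1),U(2),\dots,U(t))$ (an $m\times mt$ matrix), so that $$\underline{U}_t=\begin{pmatrix}U(0)&\xi_t'\\ \xi_t&\underline{U}_{t-1}\end{pmatrix}.$$ Here $\underline{U}_{k-1}$ is the block Toeplitz matrix of order $k-1$ built from the blocks $U(0),\dots,U(k-1)$ of $\underline{U}_k$.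 *)

theory Defs
  imports
    Complex_Main
    "Jordan_Normal_Form.Determinant"
    "Jordan_Normal_Form.Gauss_Jordan_Elimination"
begin

(* The value at z of z^k 1_m - A_1 z^(k-1) - ... - A_k. *)
definition matpoly_eval :: "nat \<Rightarrow> nat \<Rightarrow> (nat \<Rightarrow> real mat) \<Rightarrow> complex \<Rightarrow> complex mat" where
  "matpoly_eval m k A z =
     z ^ k \<cdot>\<^sub>m 1\<^sub>m m
       - mat m m (\<lambda>(i, j). \<Sum>l = 1..k. complex_of_real (A l $$ (i, j)) * z ^ (k - l))"

definition schur_stable :: "nat \<Rightarrow> nat \<Rightarrow> (nat \<Rightarrow> real mat) \<Rightarrow> bool" where
  "schur_stable m k A \<longleftrightarrow> (\<forall>z. det (matpoly_eval m k A z) = 0 \<longrightarrow> cmod z < 1)"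

(* The m x mk matrix [B_1, ..., B_k]. *)
definition block_row :: "nat \<Rightarrow> nat \<Rightarrow> (nat \<Rightarrow> real mat) \<Rightarrow> real mat" where
  "block_row m k B = mat m (m * k) (\<lambda>(i, j). B (j div m + 1) $$ (i, j mod m))"

(* Block (I, J), with I and J counted from 0, is U(J-I) if J >= I and U(I-J)' otherwise. *)
definition block_toeplitz :: "nat \<Rightarrow> nat \<Rightarrow> (nat \<Rightarrow> real mat) \<Rightarrow> real mat" where
  "block_toeplitz m t U =
     mat (m * (t + 1)) (m * (t + 1))
       (\<lambda>(i, j).
          (if i div m \<le> j div m then U (j div m - i div m)
           else transpose_mat (U (i div m - j div m))) $$ (i mod m, j mod m))"

definition pos_def_mat :: "nat \<Rightarrow> real mat \<Rightarrow> bool" where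
  "pos_def_mat n M \<longleftrightarrow>
     M \<in> carrier_mat n n \<and> transpose_mat M = M \<and>
     (\<forall>x \<in> carrier_vec n. x \<noteq> 0\<^sub>v n \<longrightarrow> 0 < x \<bullet> (M *\<^sub>v x))"

end

theory Submission
  imports Defs "Jordan_Normal_Form.Spectral_Radius"
begin

text \<open>
  The equation \<open>A = \<xi>\<^sub>k' U\<^sub>k\<^sub>-\<^sub>1\<^sup>-\<^sup>1\<close> is the Yule-Walker system: with \<open>T\<close> the Toeplitz matrix of order \<open>k\<close>, it says that
  the block row \<open>(1, -A\<^sub>1, \<dots>, -A\<^sub>k)\<close> is \<open>T\<close>-orthogonal to all vectors whose first block vanishes.

  If it holds and \<open>w A(z) = 0\<close> with \<open>w \<noteq> 0\<close>, the Horner scheme \<open>x\<^sub>0 = w\<close>, \<open>x\<^sub>l\<^sub>+\<^sub>1 = z x\<^sub>l - w A\<^sub>l\<^sub>+\<^sub>1\<close> ends in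
  \<open>x\<^sub>k = w A(z) = 0\<close>. Hence \<open>(x, 0) = z (0, x) + g\<close> with \<open>g = w (1, -A\<^sub>1, \<dots>, -A\<^sub>k)\<close> orthogonal to \<open>(0, x)\<close>.
  As \<open>T\<close> is Toeplitz, \<open>(x, 0)\<close> and \<open>(0, x)\<close> have the same squared \<open>T\<close>-norm \<open>q\<close>, so \<open>(1 - \<bar>z\<bar>\<^sup>2) q = \<parallel>g\<parallel>\<^sup>2 > 0\<close>.

  Conversely, let \<open>\<Psi>\<^sub>0, \<Psi>\<^sub>1, \<dots>\<close> be the coefficients of \<open>z\<^sup>k A(z)\<^sup>-\<^sup>1\<close> at infinity. They are blocks of the powers
  of the companion matrix, so they are summable if \<open>A\<close> is stable, and the autocovariances
  \<open>U(h) = \<Sum>\<^sub>n \<Psi>\<^sub>n\<^sub>+\<^sub>h \<Psi>\<^sub>n'\<close> of the stationary autoregressive process solve the Yule-Walker system. Their Toeplitz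
  matrix is a Gram matrix, and definite since \<open>\<Psi>\<^sub>0 = 1\<close> and \<open>\<Psi>\<^sub>n = 0\<close> for \<open>n < 0\<close>.

  Block indices are flattened: index \<open>i\<close> lies in block \<open>i div m\<close> at position \<open>i mod m\<close>, and the Toeplitz
  property reads \<open>T (i + m) (j + m) = T i j\<close>.
\<close>

section \<open>Finite sums over blocks and decay of matrix powers\<close>

lemma sum_lessThan_add:
  fixes f :: "nat \<Rightarrow> 'a::comm_monoid_add"
  shows "(\<Sum>i<n + m. f i) = (\<Sum>i<m. f i) + (\<Sum>i<n. f (i + m))"
  by (induction n) (simp_all add: ac_simps)

lemma sum_lessThan_mult:
  fixes f :: "nat \<Rightarrow> 'a::comm_monoid_add"
  shows "(\<Sum>i<m * k. f i) = (\<Sum>l<k. \<Sum>b<m. f (l * m + b))"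
proof (induction k)
  case (Suc k)
  have "(\<Sum>i<m * Suc k. f i) = (\<Sum>i<m + m * k. f i)" by simp
  also have "\<dots> = (\<Sum>i<m * k. f i) + (\<Sum>b<m. f (b + m * k))" by (rule sum_lessThan_add)
  finally show ?case using Suc by (simp add: ac_simps)
qed simp

lemma pow_smult_mat:
  fixes A :: "'a::comm_ring_1 mat"
  assumes A: "A \<in> carrier_mat n n"
  shows "(c \<cdot>\<^sub>m A) ^\<^sub>m t = c ^ t \<cdot>\<^sub>m (A ^\<^sub>m t)"
proof (induction t)
  case 0
  then show ?case using A by (intro eq_matI) auto
next
  case (Suc t)
  have "A ^\<^sub>m t \<in> carrier_mat n n" using A by (rule pow_carrier_mat)
  then show ?case using A Suc
    by (intro eq_matI) (auto simp: mult_smult_distrib[of _ n n _ n] ac_simps)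
qed

text \<open>The spectral radius is attained by an eigenvalue, so it is itself below 1 and leaves
  room for a rescaling.\<close>

lemma summable_mat_pow:
  assumes A: "A \<in> carrier_mat n n"
    and ev: "\<And>e. eigenvalue A e \<Longrightarrow> cmod e < 1"
    and ij: "i < n" "j < n"
  shows "summable (\<lambda>t. cmod ((A ^\<^sub>m t) $$ (i, j)))"
proof -
  have n: "0 < n" using ij by simp
  define s where "s = spectral_radius A"
  have s: "0 \<le> s" "s < 1"
    using spectral_radius_mem_max(1)[OF A n] ev unfolding s_def spectrum_def by auto
  \<comment> \<open>Any number strictly between \<open>s\<close> and 1 would do; it is positive, so
    division is allowed even when \<open>s = 0\<close>.\<close>
  define r where "r = (s + 1) / 2"
  have r: "0 < r" "r < 1" "s < r" using s by (auto simp: r_def)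
  \<comment> \<open>The powers of \<open>A / r\<close> are bounded, so those of \<open>A\<close> decay geometrically.\<close>
  define B where "B = complex_of_real (inverse r) \<cdot>\<^sub>m A"
  have B: "B \<in> carrier_mat n n" using A by (simp add: B_def)
  have evB: "cmod e < 1" if e: "eigenvalue B e" for e
  proof -
    obtain v where v: "v \<in> carrier_vec n" "v \<noteq> 0\<^sub>v n" "B *\<^sub>v v = e \<cdot>\<^sub>v v"
      using e unfolding eigenvalue_def eigenvector_def carrier_matD(1)[OF B] by blast
    have "A *\<^sub>v v = (r * e) \<cdot>\<^sub>v v"
    proof (rule eq_vecI)
      fix l assume "l < dim_vec ((complex_of_real r * e) \<cdot>\<^sub>v v)"
      then have l: "l < n" using v by simp
      have "(B *\<^sub>v v) $ l = inverse r * (A *\<^sub>v v) $ l"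
        using l A v(1) by (simp add: B_def)
      then show "(A *\<^sub>v v) $ l = ((r * e) \<cdot>\<^sub>v v) $ l"
        using l v r by (simp add: field_simps)
    qed (use A v in simp)
    then have "eigenvalue A (r * e)"
      using v unfolding eigenvalue_def eigenvector_def carrier_matD(1)[OF A] by blast
    then have "cmod (r * e) \<le> s"
      unfolding s_def by (intro spectral_radius_mem_max(2)[OF A n]) (simp add: spectrum_def)
    then have "r * cmod e \<le> s" using r by (simp add: norm_mult)
    then have "r * cmod e < r * 1" using r by linarith
    then show ?thesis by (rule mult_left_less_imp_less) (use r in simp)
  qed
  have "spectral_radius B < 1"
    using spectral_radius_mem_max(1)[OF B n] evB unfolding spectrum_def by auto
  moreover obtain as where "char_poly B = (\<Prod>a\<leftarrow>as. [:- a, 1:])"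
    using char_poly_factorized[OF B] by blast
  ultimately obtain c where c: "\<And>t. norm_bound (B ^\<^sub>m t) c"
    using spectral_radius_jnf_norm_bound_less_1[OF B _ jordan_nf_exists[OF B]] by blast
  have "norm (cmod ((A ^\<^sub>m t) $$ (i, j))) \<le> c * r ^ t" for t
  proof -
    have At: "A ^\<^sub>m t \<in> carrier_mat n n" using A by (rule pow_carrier_mat)
    then have "cmod ((B ^\<^sub>m t) $$ (i, j)) \<le> c"
      using c[of t] ij B by (auto simp: norm_bound_def)
    moreover have "(B ^\<^sub>m t) $$ (i, j) = inverse r ^ t * (A ^\<^sub>m t) $$ (i, j)"
      unfolding B_def pow_smult_mat[OF A] using carrier_matD[OF At] A ij by simp
    ultimately show ?thesis
      using r by (simp add: norm_mult norm_power norm_inverse norm_divide field_simps)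
  qed
  moreover have "summable (\<lambda>t. c * r ^ t)"
    using r by (intro summable_mult summable_geometric) simp
  ultimately show ?thesis
    by (rule summable_comparison_test'[where N = 0, rotated])
qed

section \<open>Yule-Walker equations on flattened indices\<close>

text \<open>Here \<open>n\<close> stands for \<open>m * k\<close>, \<open>T\<close> for the Toeplitz
  matrix, \<open>\<alpha>\<close> for the block row of coefficients, and \<open>x\<close> for the
  Horner sequence including its final zero block.\<close>

lemma yule_walker_root_bound:
  fixes T \<alpha> :: "nat \<Rightarrow> nat \<Rightarrow> real" and x :: "nat \<Rightarrow> complex"
  assumes sym: "\<And>i j. i < n + m \<Longrightarrow> j < n + m \<Longrightarrow> T i j = T j i"
    and pd: "\<And>v. \<exists>i<n + m. v i \<noteq> 0 \<Longrightarrow> 0 < (\<Sum>i<n + m. \<Sum>j<n + m. v i * T i j * v j)"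
    and shift: "\<And>i j. i < n \<Longrightarrow> j < n \<Longrightarrow> T (i + m) (j + m) = T i j"
    and yw: "\<And>a j. a < m \<Longrightarrow> j < n \<Longrightarrow> (\<Sum>i<n. \<alpha> a i * T i j) = T a (j + m)"
    and x_rec: "\<And>i. i < n \<Longrightarrow> x (i + m) = z * x i - (\<Sum>a<m. x a * \<alpha> a i)"
    and x_top: "\<And>i. n \<le> i \<Longrightarrow> i < n + m \<Longrightarrow> x i = 0"
    and x_nz: "\<exists>a<m. x a \<noteq> 0"
  shows "cmod z < 1"
proof -
  \<comment> \<open>The Hermitian extension of \<open>T\<close>, since \<open>z\<close> and
    \<open>x\<close> are complex.\<close>
  define H where "H u v = (\<Sum>i<n + m. \<Sum>j<n + m. u i * T i j * cnj (v j))" for u v :: "nat \<Rightarrow> complex"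
  define Q where "Q v = (\<Sum>i<n + m. \<Sum>j<n + m. v i * T i j * v j)" for v :: "nat \<Rightarrow> real"
  have Q_nonneg: "0 \<le> Q v" for v
  proof (cases "\<exists>i<n + m. v i \<noteq> 0")
    case True
    then show ?thesis using pd[of v] by (simp add: Q_def)
  next
    case False
    then have "Q v = 0" unfolding Q_def by (intro sum.neutral ballI) auto
    then show ?thesis by simp
  qed
  \<comment> \<open>As \<open>T\<close> is real, mixed products of real and imaginary parts are
    purely imaginary and drop out.\<close>
  have Re_H: "Re (H v v) = Q (\<lambda>i. Re (v i)) + Q (\<lambda>i. Im (v i))" for v
    unfolding H_def Q_def Re_sum sum.distrib[symmetric] by (intro sum.cong refl) simp
  have H_cnj: "H u v = cnj (H v u)" for u v
  proof -
    have "H u v = (\<Sum>j<n + m. \<Sum>i<n + m. u i * T i j * cnj (v j))"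
      unfolding H_def by (rule sum.swap)
    also have "\<dots> = cnj (H v u)"
      unfolding H_def cnj_sum by (intro sum.cong refl) (auto simp: sym mult_ac)
    finally show ?thesis .
  qed
  \<comment> \<open>\<open>y\<close> delays \<open>x\<close> by one block; \<open>g\<close> is
    \<open>w (1, -A_1, ..., -A_k)\<close> with \<open>w\<close> the first block of
    \<open>x\<close>.\<close>
  define y where "y i = (if i < m then 0 else x (i - m))" for i
  define g where "g i = (if i < m then x i else - (\<Sum>a<m. x a * \<alpha> a (i - m)))" for i
  have x_decomp: "x i = z * y i + g i" if "i < n + m" for i
    using that x_rec[of "i - m"] by (auto simp: y_def g_def)
  \<comment> \<open>The last block of \<open>x\<close> and the first block of \<open>y\<close>
    vanish, so both forms reduce to the leading \<open>n\<close> by \<open>n\<close> part of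
    \<open>T\<close>, for \<open>y\<close> by \<open>shift\<close>.\<close>
  have "H x x = (\<Sum>i<n. \<Sum>j<n. x i * T i j * cnj (x j))"
  proof -
    have *: "(\<Sum>j<n + m. x i * T i j * cnj (x j)) = (\<Sum>j<n. x i * T i j * cnj (x j))" for i
      by (intro sum.mono_neutral_right) (auto simp: x_top)
    show ?thesis unfolding H_def *
      by (intro sum.mono_neutral_right) (auto simp: x_top)
  qed
  also have "\<dots> = H y y"
    unfolding H_def sum_lessThan_add by (simp add: y_def shift)
  finally have H_xy: "H x x = H y y" .
  \<comment> \<open>Only columns \<open>j + m\<close> of \<open>T\<close> meet \<open>y\<close>;
    there the first block of \<open>g\<close> contributes \<open>T a (j + m)\<close>, and the
    remaining blocks cancel it by \<open>shift\<close> and \<open>yw\<close>.\<close>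
  have H_gy: "H g y = 0"
  proof -
    have "(\<Sum>i<n + m. g i * T i (j + m)) = 0" if j: "j < n" for j
    proof -
      have "(\<Sum>i<n + m. g i * T i (j + m)) =
          (\<Sum>a<m. x a * T a (j + m)) - (\<Sum>i<n. \<Sum>a<m. x a * \<alpha> a i * T i j)"
        unfolding sum_lessThan_add
        by (simp add: g_def shift j sum_negf sum_distrib_right)
      also have "(\<Sum>i<n. \<Sum>a<m. x a * \<alpha> a i * T i j) =
          (\<Sum>a<m. x a * complex_of_real (\<Sum>i<n. \<alpha> a i * T i j))"
        by (subst sum.swap) (simp add: sum_distrib_left mult.assoc)
      finally show ?thesis by (simp add: yw j)
    qed
    moreover have "H g y = (\<Sum>j<n. (\<Sum>i<n + m. g i * T i (j + m)) * cnj (x j))"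
      unfolding H_def
      by (subst sum.swap, subst sum_lessThan_add) (simp add: y_def sum_distrib_right)
    ultimately show ?thesis by simp
  qed
  have "H x x = (\<Sum>i<n + m. \<Sum>j<n + m. (z * y i + g i) * T i j * cnj (z * y j + g j))"
    unfolding H_def by (intro sum.cong refl) (auto simp: x_decomp)
  also have "\<dots> = z * cnj z * H y y + z * H y g + cnj z * H g y + H g g"
    unfolding H_def sum_distrib_left sum.distrib[symmetric]
    by (intro sum.cong refl) (simp add: algebra_simps)
  also have "H y g = 0" using H_cnj[of y g] H_gy by simp
  finally have "H y y = complex_of_real ((cmod z)\<^sup>2) * H y y + H g g"
    using H_xy H_gy complex_norm_square[of z] by simp
  then have "Re (H y y) = Re (complex_of_real ((cmod z)\<^sup>2) * H y y + H g g)"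
    by (rule arg_cong)
  then have eq: "Re (H y y) = (cmod z)\<^sup>2 * Re (H y y) + Re (H g g)"
    by (simp only: Re_complex_of_real Im_complex_of_real plus_complex.sel times_complex.sel
        mult_zero_left diff_zero)
  \<comment> \<open>The first block of \<open>g\<close> is that of \<open>x\<close>, hence nonzero;
    one nonzero real or imaginary part suffices because both quadratic forms are
    nonnegative.\<close>
  have "0 < Re (H g g)"
  proof -
    obtain a where a: "a < m" "x a \<noteq> 0" using x_nz by blast
    then consider "Re (g a) \<noteq> 0" | "Im (g a) \<noteq> 0" by (auto simp: g_def complex_eq_iff)
    then show ?thesis
    proof cases
      case 1
      then have "0 < Q (\<lambda>i. Re (g i))" using a unfolding Q_def by (intro pd exI[of _ a]) simp
      then show ?thesis using Q_nonneg[of "\<lambda>i. Im (g i)"] by (simp add: Re_H)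
    next
      case 2
      then have "0 < Q (\<lambda>i. Im (g i))" using a unfolding Q_def by (intro pd exI[of _ a]) simp
      then show ?thesis using Q_nonneg[of "\<lambda>i. Re (g i)"] by (simp add: Re_H)
    qed
  qed
  \<comment> \<open>If the squared modulus of \<open>z\<close> were at least 1, the right side of
    \<open>eq\<close> would exceed the left.\<close>
  moreover have "0 \<le> Re (H y y)" by (simp add: Re_H Q_nonneg)
  ultimately have "(cmod z)\<^sup>2 < 1"
    using eq by (smt (verit) mult_le_cancel_right1)
  then show ?thesis by (simp add: power_less_one_iff abs_square_less_1)
qed

text \<open>Read \<open>F t i c\<close> as the response at time \<open>t\<close> of coordinate
  \<open>i mod m\<close>, delayed by \<open>i div m\<close> steps, to a unit shock in coordinate
  \<open>c\<close> at time 0. \<open>G\<close> is then the process covariance, and unbounded indices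
  cover all lags at once.\<close>

lemma yule_walker_solution:
  fixes F :: "nat \<Rightarrow> nat \<Rightarrow> nat \<Rightarrow> real" and \<alpha> :: "nat \<Rightarrow> nat \<Rightarrow> real"
  assumes m: "0 < m"
    and F_0: "\<And>i c. c < m \<Longrightarrow> F 0 i c = (if i = c then 1 else 0)"
    and F_shift: "\<And>t i c. F (Suc t) (i + m) c = F t i c"
    and F_rec: "\<And>t a c. a < m \<Longrightarrow> c < m \<Longrightarrow> F (Suc t) a c = (\<Sum>i<n. \<alpha> a i * F t i c)"
    and F_summable: "\<And>i c. c < m \<Longrightarrow> summable (\<lambda>t. \<bar>F t i c\<bar>)"
  obtains G :: "nat \<Rightarrow> nat \<Rightarrow> real"
  where "\<And>i j. G i j = G j i"
    and "\<And>i j. G (i + m) (j + m) = G i j"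
    and "\<And>a j. a < m \<Longrightarrow> (\<Sum>i<n. \<alpha> a i * G i j) = G a (j + m)"
    and "\<And>N (v :: nat \<Rightarrow> real). \<exists>i<N. v i \<noteq> 0 \<Longrightarrow> 0 < (\<Sum>i<N. \<Sum>j<N. v i * G i j * v j)"
proof -
  define h where "h i j t = (\<Sum>c<m. F t i c * F t j c)" for i j t
  define G where "G i j = suminf (h i j)" for i j
  have summable_h: "summable (h i j)" for i j
    unfolding h_def
  proof (rule summable_sum)
    fix c assume "c \<in> {..<m}"
    then have c: "c < m" by simp
    \<comment> \<open>One factor is bounded since it tends to zero, so absolute summability of the
      other controls the product.\<close>
    have "(\<lambda>t. \<bar>F t i c\<bar>) \<longlonglongrightarrow> 0" using F_summable[OF c] by (rule summable_LIMSEQ_zero)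
    then have "Bseq (\<lambda>t. \<bar>F t i c\<bar>)" by (intro convergent_imp_Bseq convergentI)
    then obtain K where "\<forall>t. norm \<bar>F t i c\<bar> \<le> K" unfolding Bseq_def by blast
    then have K: "\<bar>F t i c\<bar> \<le> K" for t by simp
    have "norm (F t i c * F t j c) \<le> K * \<bar>F t j c\<bar>" for t
      unfolding real_norm_def abs_mult by (rule mult_right_mono[OF K]) simp
    moreover have "summable (\<lambda>t. K * \<bar>F t j c\<bar>)"
      by (intro summable_mult F_summable c)
    ultimately show "summable (\<lambda>t. F t i c * F t j c)"
      by (rule summable_comparison_test'[where N = 0, rotated])
  qed
  then have h_sums: "h i j sums G i j" for i j
    by (simp add: G_def summable_sums)
  \<comment> \<open>A delayed coordinate is not yet hit at time 0, so the series for
    \<open>G i (j + m)\<close> may start at time 1. Both the Toeplitz property and the recursion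
    rest on this.\<close>
  have h_0: "h i (j + m) 0 = 0" for i j
    by (auto simp: h_def F_0 intro!: sum.neutral)
  have G_head: "G i (j + m) = (\<Sum>t. h i (j + m) (Suc t))" for i j
    using suminf_split_head[OF summable_h[of i "j + m"]] by (simp add: G_def h_0)
  have "h i j = h j i" for i j
    by (rule ext) (simp add: h_def mult.commute)
  then have G_sym: "G i j = G j i" for i j
    by (simp only: G_def)
  have "(\<lambda>t. h (i + m) (j + m) (Suc t)) = h i j" for i j
    by (rule ext) (simp add: h_def F_shift)
  then have G_shift: "G (i + m) (j + m) = G i j" for i j
    unfolding G_head by (simp only: G_def)
  have G_rec: "(\<Sum>i<n. \<alpha> a i * G i j) = G a (j + m)" if a: "a < m" for a j
  proof -
    have "(\<lambda>t. \<Sum>i<n. \<alpha> a i * h i j t) sums (\<Sum>i<n. \<alpha> a i * G i j)"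
      by (intro sums_sum sums_mult h_sums)
    moreover have "(\<Sum>i<n. \<alpha> a i * h i j t) = h a (j + m) (Suc t)" for t
    proof -
      have "(\<Sum>i<n. \<alpha> a i * h i j t) = (\<Sum>c<m. (\<Sum>i<n. \<alpha> a i * F t i c) * F t j c)"
        unfolding h_def sum_distrib_left sum_distrib_right
        by (subst sum.swap) (simp add: mult.assoc)
      also have "\<dots> = h a (j + m) (Suc t)"
        unfolding h_def by (intro sum.cong refl) (auto simp: F_rec a F_shift)
      finally show ?thesis .
    qed
    ultimately show ?thesis by (simp add: G_head sums_unique)
  qed
  have G_pos: "0 < (\<Sum>i<N. \<Sum>j<N. v i * G i j * v j)" if "\<exists>i<N. v i \<noteq> 0" for N and v :: "nat \<Rightarrow> real"
  proof -
    \<comment> \<open>The quadratic form at each time is a sum of squares, so one strictly positive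
      time is enough.\<close>
    define q where "q t = (\<Sum>c<m. (\<Sum>i<N. v i * F t i c)\<^sup>2)" for t
    have "(\<Sum>i<N. \<Sum>j<N. v i * h i j t * v j) = q t" for t
    proof -
      have "(\<Sum>i<N. \<Sum>j<N. v i * h i j t * v j) =
          (\<Sum>i<N. \<Sum>j<N. \<Sum>c<m. (v i * F t i c) * (v j * F t j c))"
        unfolding h_def
        by (intro sum.cong refl) (simp add: sum_distrib_left sum_distrib_right mult_ac)
      also have "\<dots> = (\<Sum>i<N. \<Sum>c<m. \<Sum>j<N. (v i * F t i c) * (v j * F t j c))"
        by (intro sum.cong refl sum.swap)
      also have "\<dots> = (\<Sum>c<m. \<Sum>i<N. \<Sum>j<N. (v i * F t i c) * (v j * F t j c))"
        by (rule sum.swap)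
      finally show ?thesis by (simp add: q_def power2_eq_square sum_product)
    qed
    moreover have "(\<lambda>t. \<Sum>i<N. \<Sum>j<N. v i * h i j t * v j) sums (\<Sum>i<N. \<Sum>j<N. v i * G i j * v j)"
      by (intro sums_sum sums_mult sums_mult2 h_sums)
    ultimately have q_sums: "q sums (\<Sum>i<N. \<Sum>j<N. v i * G i j * v j)"
      by simp
    \<comment> \<open>At time \<open>i div m\<close> the response in coordinate \<open>i mod m\<close> vanishes at all later indices, so it isolates \<open>v i\<close>.\<close>
    define i where "i = (LEAST i. i < N \<and> v i \<noteq> 0)"
    have i: "i < N" "v i \<noteq> 0" using LeastI_ex[OF that] by (auto simp: i_def)
    have less_i: "v j = 0" if "j < i" for j
      using not_less_Least[of j "\<lambda>i. i < N \<and> v i \<noteq> 0"] that i(1) by (auto simp: i_def)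
    define t c where "t = i div m" and "c = i mod m"
    have c: "c < m" using m by (simp add: c_def)
    have F_diag: "F s (s * m + c + d) c = (if d = 0 then 1 else 0)" for s d
    proof (induction s)
      case (Suc s)
      then show ?case using F_shift[of s "s * m + c + d" c] by (simp add: ac_simps)
    qed (use c in \<open>simp add: F_0\<close>)
    have F_ge: "F t j c = (if j = i then 1 else 0)" if "i \<le> j" for j
      using F_diag[of t "j - i"] that by (simp add: t_def c_def)
    \<comment> \<open>Smaller indices drop out by minimality of \<open>i\<close>, larger ones by
      \<open>F_ge\<close>.\<close>
    have "v j * F t j c = (if j = i then v i else 0)" for j
      by (cases "j < i") (simp_all add: less_i F_ge)
    then have "(\<Sum>j<N. v j * F t j c) = v i" using i by simp
    then have "0 < q t"
      unfolding q_def using i c by (intro sum_pos2[of _ c]) auto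
    moreover have "0 \<le> q s" for s by (auto simp: q_def intro: sum_nonneg)
    ultimately show ?thesis
      using suminf_pos_iff[OF sums_summable[OF q_sums]] sums_unique[OF q_sums] by auto
  qed
  show ?thesis
    by (rule that) (fact G_sym G_shift G_rec G_pos)+
qed

section \<open>Positive definiteness and inverses\<close>

lemma pos_def_mat_iff:
  "pos_def_mat n M \<longleftrightarrow> M \<in> carrier_mat n n \<and> (\<forall>i<n. \<forall>j<n. M $$ (i, j) = M $$ (j, i)) \<and>
    (\<forall>v. (\<exists>i<n. v i \<noteq> 0) \<longrightarrow> 0 < (\<Sum>i<n. \<Sum>j<n. v i * M $$ (i, j) * v j))"
proof (cases "M \<in> carrier_mat n n")
  case True
  have form: "vec n v \<bullet> (M *\<^sub>v vec n v) = (\<Sum>i<n. \<Sum>j<n. v i * M $$ (i, j) * v j)" for v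
    using True by (auto simp: scalar_prod_def sum_distrib_left atLeast0LessThan mult.assoc intro!: sum.cong)
  have nz: "vec n v \<noteq> 0\<^sub>v n \<longleftrightarrow> (\<exists>i<n. v i \<noteq> 0)" for v :: "nat \<Rightarrow> real"
    by (auto simp: vec_eq_iff)
  have "(\<forall>x \<in> carrier_vec n. x \<noteq> 0\<^sub>v n \<longrightarrow> 0 < x \<bullet> (M *\<^sub>v x)) \<longleftrightarrow>
      (\<forall>v. (\<exists>i<n. v i \<noteq> 0) \<longrightarrow> 0 < (\<Sum>i<n. \<Sum>j<n. v i * M $$ (i, j) * v j))"
    (is "?l \<longleftrightarrow> ?r")
  proof
    assume ?l
    show ?r unfolding form[symmetric] nz[symmetric] using \<open>?l\<close> by simp
  next
    assume r: ?r
    show ?l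
    proof (intro ballI impI)
      fix x :: "real vec" assume x: "x \<in> carrier_vec n" "x \<noteq> 0\<^sub>v n"
      then have "vec n (\<lambda>i. x $ i) = x" by auto
      then show "0 < x \<bullet> (M *\<^sub>v x)"
        using r x nz[of "\<lambda>i. x $ i"] form[of "\<lambda>i. x $ i"] by simp
    qed
  qed
  moreover have "transpose_mat M = M \<longleftrightarrow> (\<forall>i<n. \<forall>j<n. M $$ (i, j) = M $$ (j, i))"
    using True by (auto simp: mat_eq_iff)
  ultimately show ?thesis using True unfolding pos_def_mat_def by blast
qed (simp add: pos_def_mat_def)

text \<open>Test vectors are extended by zeros.\<close>

lemma pos_def_mat_leading:
  assumes M: "pos_def_mat (n + m) M" and M': "M' \<in> carrier_mat n n"
    and eq: "\<And>i j. i < n \<Longrightarrow> j < n \<Longrightarrow> M' $$ (i, j) = M $$ (i, j)"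
  shows "pos_def_mat n M'"
  unfolding pos_def_mat_iff
proof (intro conjI allI impI)
  fix v :: "nat \<Rightarrow> real"
  assume "\<exists>i<n. v i \<noteq> 0"
  then obtain l where l: "l < n" "v l \<noteq> 0" by blast
  define u where "u i = (if i < n then v i else 0)" for i
  have "0 < (\<Sum>i<n + m. \<Sum>j<n + m. u i * M $$ (i, j) * u j)"
  proof -
    have "u l \<noteq> 0" "l < n + m" using l by (auto simp: u_def)
    then show ?thesis using M unfolding pos_def_mat_iff by blast
  qed
  also have "\<dots> = (\<Sum>i<n. \<Sum>j<n + m. u i * M $$ (i, j) * u j)"
    by (intro sum.mono_neutral_right) (auto simp: u_def)
  also have "\<dots> = (\<Sum>i<n. \<Sum>j<n. u i * M $$ (i, j) * u j)"
    by (intro sum.cong refl sum.mono_neutral_right) (auto simp: u_def)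
  also have "\<dots> = (\<Sum>i<n. \<Sum>j<n. v i * M' $$ (i, j) * v j)"
    by (intro sum.cong refl) (auto simp: u_def eq)
  finally show "0 < (\<Sum>i<n. \<Sum>j<n. v i * M' $$ (i, j) * v j)" .
next
  fix i j assume "i < n" "j < n"
  moreover have "\<forall>i<n + m. \<forall>j<n + m. M $$ (i, j) = M $$ (j, i)"
    using M unfolding pos_def_mat_iff by blast
  ultimately show "M' $$ (i, j) = M' $$ (j, i)" unfolding eq[OF \<open>i < n\<close> \<open>j < n\<close>] eq[OF \<open>j < n\<close> \<open>i < n\<close>] by auto
qed (fact M')

text \<open>A definite matrix has trivial kernel, so \<open>mat_inverse\<close> returns a genuine
  two-sided inverse and \<open>the\<close> is meaningful.\<close>

lemma pos_def_mat_inverse: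
  assumes M: "pos_def_mat n M" and R: "R \<in> carrier_mat m n" and S: "S \<in> carrier_mat m n"
  shows "R = S * the (mat_inverse M) \<longleftrightarrow> R * M = S"
proof -
  have M_carrier: "M \<in> carrier_mat n n" using M by (simp add: pos_def_mat_def)
  have "det M \<noteq> 0"
  proof
    assume "det M = 0"
    then obtain v where v: "v \<in> carrier_vec n" "v \<noteq> 0\<^sub>v n" "M *\<^sub>v v = 0\<^sub>v n"
      using det_0_iff_vec_prod_zero[OF M_carrier] by blast
    then have "0 < v \<bullet> (M *\<^sub>v v)" using M unfolding pos_def_mat_def by blast
    then show False using v by simp
  qed
  then have "M \<in> Units (ring_mat TYPE(real) n n)"
    by (rule det_non_zero_imp_unit[OF M_carrier])
  then have "mat_inverse M \<noteq> None"
    using mat_inverse(1)[OF M_carrier, where b = n] by blast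
  then obtain B where inv: "mat_inverse M = Some B" by blast
  then have B: "M * B = 1\<^sub>m n" "B * M = 1\<^sub>m n" "B \<in> carrier_mat n n"
    using mat_inverse(2)[OF M_carrier] by auto
  have "R * M * B = R"
    using R by (simp add: assoc_mult_mat[OF R M_carrier B(3)] B(1))
  moreover have "S * B * M = S"
    using S by (simp add: assoc_mult_mat[OF S B(3) M_carrier] B(2))
  ultimately show ?thesis by (auto simp: inv)
qed

section \<open>Entries of the matrix polynomial and its companion matrix\<close>

lemma matpoly_eval_carrier [simp]: "matpoly_eval m k A z \<in> carrier_mat m m"
  unfolding matpoly_eval_def by (rule minus_carrier_mat) simp

lemma matpoly_eval_index:
  assumes "a < m" "b < m"
  shows "matpoly_eval m k A z $$ (a, b) =
    (if a = b then z ^ k else 0) - (\<Sum>l<k. complex_of_real (A (Suc l) $$ (a, b)) * z ^ (k - Suc l))"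
  using assms by (simp add: matpoly_eval_def sum.atLeast1_atMost_eq)

lemma block_row_index:
  assumes "a < m" "i < m * k"
  shows "block_row m k B $$ (a, i) = B (Suc (i div m)) $$ (a, i mod m)"
  using assms by (simp add: block_row_def)

lemma block_row_index_block:
  assumes "a < m" "b < m" "l < k"
  shows "block_row m k B $$ (a, l * m + b) = B (Suc l) $$ (a, b)"
proof -
  have "l * m + b < Suc l * m" using assms by simp
  also have "\<dots> \<le> k * m" using assms by (intro mult_le_mono1) simp
  finally show ?thesis using assms by (simp add: block_row_index mult.commute)
qed

text \<open>The transition matrix of the autoregression on a stack of \<open>k\<close> consecutive
  blocks, newest first.\<close>

definition companion :: "nat \<Rightarrow> nat \<Rightarrow> (nat \<Rightarrow> real mat) \<Rightarrow> real mat" where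
  "companion m k A = mat (m * k) (m * k)
     (\<lambda>(i, j). if i < m then block_row m k A $$ (i, j) else if j = i - m then 1 else 0)"

lemma companion_carrier [simp]: "companion m k A \<in> carrier_mat (m * k) (m * k)"
  by (simp add: companion_def)

text \<open>The general codomain serves complex eigenvectors and real matrix powers alike.\<close>

lemma companion_index_mult:
  fixes f :: "nat \<Rightarrow> 'a::real_algebra_1"
  assumes "i < m * k"
  shows "(\<Sum>j<m * k. of_real (companion m k A $$ (i, j)) * f j) =
    (if i < m then \<Sum>j<m * k. of_real (block_row m k A $$ (i, j)) * f j else f (i - m))"
proof (cases "i < m")
  case True
  then show ?thesis using assms by (simp add: companion_def)
next
  case False
  then have "(\<Sum>j<m * k. of_real (companion m k A $$ (i, j)) * f j) =
      (\<Sum>j<m * k. if j = i - m then f (i - m) else 0)"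
    using assms by (intro sum.cong refl) (auto simp: companion_def)
  moreover have "i - m < m * k" using assms by simp
  ultimately show ?thesis using False by simp
qed

text \<open>The shift rows force an eigenvector to have blocks
  \<open>e^(k-1) u, ..., e u, u\<close>; the top block row then says
  \<open>A(e) u = 0\<close>.\<close>

lemma companion_eigenvalue:
  assumes m: "0 < m" and k: "0 < k"
    and "eigenvalue (map_mat complex_of_real (companion m k A)) e"
  shows "det (matpoly_eval m k A e) = 0"
proof -
  let ?C = "map_mat complex_of_real (companion m k A)"
  have C: "?C \<in> carrier_mat (m * k) (m * k)" by simp
  obtain v where v: "v \<in> carrier_vec (m * k)" "v \<noteq> 0\<^sub>v (m * k)" "?C *\<^sub>v v = e \<cdot>\<^sub>v v"
    using assms(3) unfolding eigenvalue_def eigenvector_def carrier_matD(1)[OF C] by blast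
  have Cv: "(if i < m then \<Sum>j<m * k. complex_of_real (block_row m k A $$ (i, j)) * v $ j else v $ (i - m))
      = e * v $ i" if i: "i < m * k" for i
  proof -
    have "(\<Sum>j<m * k. complex_of_real (companion m k A $$ (i, j)) * v $ j) = (?C *\<^sub>v v) $ i"
      using i v(1) C carrier_matD[OF companion_carrier[of m k A]]
      by (simp add: scalar_prod_def atLeast0LessThan)
    then show ?thesis using i v(1) by (simp add: v(3) companion_index_mult)
  qed
  \<comment> \<open>Working upwards from the last block only multiplies by \<open>e\<close>, so
    \<open>e = 0\<close> needs no separate case.\<close>
  define u where "u b = v $ ((k - 1) * m + b)" for b
  have v_u: "v $ ((k - 1 - d) * m + b) = e ^ d * u b" if "b < m" "d < k" for b d
    using that(2)
  proof (induction d)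
    case (Suc d)
    define i where "i = (k - 1 - d) * m + b"
    have *: "k - 1 - d = Suc (k - 1 - Suc d)" using Suc.prems by simp
    have "i < Suc (k - 1 - d) * m" using that by (simp add: i_def)
    also have "\<dots> \<le> k * m" using Suc.prems by (intro mult_le_mono1) simp
    finally have "i < m * k" by (simp add: mult.commute)
    moreover have "m \<le> i" "i - m = (k - 1 - Suc d) * m + b" unfolding i_def * by simp_all
    ultimately have "v $ ((k - 1 - Suc d) * m + b) = e * v $ i" using Cv[of i] by simp
    then show ?case using Suc by (simp add: i_def)
  qed (simp add: u_def)
  have v_block: "v $ (l * m + b) = e ^ (k - Suc l) * u b" if "b < m" "l < k" for b l
  proof -
    have "k - 1 - (k - Suc l) = l" using that by simp
    then show ?thesis using v_u[of b "k - Suc l"] that by simp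
  qed
  have "matpoly_eval m k A e *\<^sub>v vec m u = 0\<^sub>v m"
  proof (rule eq_vecI)
    fix a assume "a < dim_vec (0\<^sub>v m :: complex vec)"
    then have a: "a < m" by simp
    then have a': "a < m * k" using k by (cases k) auto
    have "(matpoly_eval m k A e *\<^sub>v vec m u) $ a =
        (\<Sum>b<m. (if a = b then e ^ k * u b else 0) -
          (\<Sum>l<k. complex_of_real (A (Suc l) $$ (a, b)) * (e ^ (k - Suc l) * u b)))"
      using a carrier_matD[OF matpoly_eval_carrier[of m k A e]]
      by (auto simp: scalar_prod_def atLeast0LessThan matpoly_eval_index left_diff_distrib
          sum_distrib_right mult.assoc intro!: sum.cong)
    also have "\<dots> = e ^ k * u a -
        (\<Sum>b<m. \<Sum>l<k. complex_of_real (A (Suc l) $$ (a, b)) * (e ^ (k - Suc l) * u b))"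
      using a by (simp add: sum_subtractf)
    also have "(\<Sum>b<m. \<Sum>l<k. complex_of_real (A (Suc l) $$ (a, b)) * (e ^ (k - Suc l) * u b)) =
        (\<Sum>l<k. \<Sum>b<m. complex_of_real (block_row m k A $$ (a, l * m + b)) * v $ (l * m + b))"
      by (subst sum.swap, intro sum.cong refl) (simp add: block_row_index_block a v_block)
    also have "\<dots> = e * v $ a"
      using Cv[OF a'] a by (simp add: sum_lessThan_mult)
    also have "\<dots> = e ^ k * u a"
      using v_block[OF a, of 0] k by (simp add: power_eq_if)
    finally show "(matpoly_eval m k A e *\<^sub>v vec m u) $ a = 0\<^sub>v m $ a" using a by simp
  qed (use carrier_matD[OF matpoly_eval_carrier[of m k A e]] in simp)
  moreover have "vec m u \<noteq> 0\<^sub>v m"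
  proof
    assume "vec m u = 0\<^sub>v m"
    then have u0: "u b = 0" if "b < m" for b using that by (auto simp: vec_eq_iff)
    have "v $ i = 0" if "i < m * k" for i
    proof -
      have "i div m < k" using that by (simp add: less_mult_imp_div_less mult.commute)
      then show ?thesis using v_block[of "i mod m" "i div m"] u0[of "i mod m"] m by simp
    qed
    then have "v = 0\<^sub>v (m * k)" using v(1) by auto
    then show False using v(2) by simp
  qed
  ultimately show ?thesis
    using det_0_iff_vec_prod_zero[OF matpoly_eval_carrier[of m k A e]] by (metis vec_carrier)
qed

section \<open>Powers of the companion matrix and impulse responses\<close>

text \<open>\<open>pow_mat\<close> multiplies on the right, but the row structure of the companion
  matrix acts from the left.\<close>

lemma companion_pow_Suc:
  "companion m k A ^\<^sub>m Suc t = companion m k A * companion m k A ^\<^sub>m t"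
proof (induction t)
  case (Suc t)
  have "companion m k A ^\<^sub>m t \<in> carrier_mat (m * k) (m * k)" by (intro pow_carrier_mat) simp
  then show ?case using Suc
    by (metis assoc_mult_mat companion_carrier pow_mat.simps(2))
qed (use carrier_matD[OF companion_carrier[of m k A]] in simp)

text \<open>The entry \<open>(i mod m, c)\<close> of the coefficient of \<open>z\<close> to the power \<open>-(t - i div m)\<close> in the expansion
  of \<open>z^k A(z)^-1\<close> at infinity.\<close>
definition impulse :: "nat \<Rightarrow> nat \<Rightarrow> (nat \<Rightarrow> real mat) \<Rightarrow> nat \<Rightarrow> nat \<Rightarrow> nat \<Rightarrow> real" where
  "impulse m k A t i c =
     (if t < i div m then 0 else (companion m k A ^\<^sub>m (t - i div m)) $$ (i mod m, c))"

lemma impulse_shift: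
  assumes "0 < m"
  shows "impulse m k A (Suc t) (i + m) c = impulse m k A t i c"
  using assms by (simp add: impulse_def)

lemma impulse_0:
  assumes "c < m" "0 < k"
  shows "impulse m k A 0 i c = (if i = c then 1 else 0)"
proof (cases "i < m")
  case True
  then have "i < m * k" "c < m * k" using assms by (auto intro: less_le_trans)
  then show ?thesis using True assms carrier_matD[OF companion_carrier[of m k A]]
    by (simp add: impulse_def)
next
  case False
  then show ?thesis using assms by (auto simp: impulse_def div_greater_zero_iff)
qed

lemma companion_pow_Suc_index:
  assumes "i < m * k" "c < m * k"
  shows "(companion m k A ^\<^sub>m Suc t) $$ (i, c) =
    (if i < m then \<Sum>j<m * k. block_row m k A $$ (i, j) * (companion m k A ^\<^sub>m t) $$ (j, c)
     else (companion m k A ^\<^sub>m t) $$ (i - m, c))"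
proof -
  have t: "companion m k A ^\<^sub>m t \<in> carrier_mat (m * k) (m * k)" by (intro pow_carrier_mat) simp
  have "(companion m k A ^\<^sub>m Suc t) $$ (i, c) =
      (\<Sum>j<m * k. companion m k A $$ (i, j) * (companion m k A ^\<^sub>m t) $$ (j, c))"
    unfolding companion_pow_Suc
    using assms carrier_matD[OF companion_carrier[of m k A]] carrier_matD[OF t]
    by (simp add: scalar_prod_def atLeast0LessThan)
  then show ?thesis
    using companion_index_mult[OF assms(1), of A "\<lambda>j. (companion m k A ^\<^sub>m t) $$ (j, c)"] by simp
qed

text \<open>Each lower block row copies the block above it from the previous power, so a block of
  the first block column is the top block \<open>i div m\<close> steps earlier. Before that it is
  zero, because power 0 is the identity.\<close>

lemma companion_pow_index:
  assumes "c < m" "i < m * k"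
  shows "(companion m k A ^\<^sub>m t) $$ (i, c) = impulse m k A t i c"
proof -
  have m: "0 < m" and k: "0 < k" using assms by (auto intro!: gr0I)
  then have c: "c < m * k" using assms(1) by (auto intro: less_le_trans)
  show ?thesis using assms(2)
  proof (induction t arbitrary: i)
    case 0
    then show ?case using impulse_0[OF assms(1) k] c carrier_matD[OF companion_carrier[of m k A]]
      by simp
  next
    case (Suc t)
    show ?case
    proof (cases "i < m")
      case True
      then show ?thesis by (simp add: impulse_def)
    next
      case False
      then have "i - m < m * k" "i = (i - m) + m" using Suc.prems by simp_all
      then show ?thesis
        using companion_pow_Suc_index[OF Suc.prems c, of A t] Suc.IH[of "i - m"] False
          impulse_shift[OF m, of k A t "i - m" c] by simp
    qed
  qed
qed

lemma impulse_rec: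
  assumes "a < m" "c < m" "0 < k"
  shows "impulse m k A (Suc t) a c = (\<Sum>i<m * k. block_row m k A $$ (a, i) * impulse m k A t i c)"
proof -
  have "a < m * k" "c < m * k" using assms by (auto intro: less_le_trans)
  then show ?thesis
    using assms companion_pow_Suc_index[of a m k c A t] companion_pow_index[of c m a k A "Suc t"]
    by (simp add: companion_pow_index)
qed

lemma impulse_summable:
  assumes stable: "schur_stable m k A" and c: "c < m" and k: "0 < k"
  shows "summable (\<lambda>t. \<bar>impulse m k A t i c\<bar>)"
proof -
  let ?C = "map_mat complex_of_real (companion m k A)"
  have m: "0 < m" using c by simp
  have less: "i mod m < m * k" "c < m * k"
    using m k c by (auto intro: less_le_trans[OF mod_less_divisor] less_le_trans)
  have "cmod e < 1" if "eigenvalue ?C e" for e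
    using companion_eigenvalue[OF m k that] stable unfolding schur_stable_def by blast
  then have "summable (\<lambda>t. cmod ((?C ^\<^sub>m t) $$ (i mod m, c)))"
    by (intro summable_mat_pow[of _ "m * k"] less) simp_all
  \<comment> \<open>The delay by \<open>i div m\<close> only shifts the series, which preserves
    summability.\<close>
  moreover have "cmod ((?C ^\<^sub>m t) $$ (i mod m, c)) = \<bar>impulse m k A (t + i div m) i c\<bar>" for t
  proof -
    have t: "companion m k A ^\<^sub>m t \<in> carrier_mat (m * k) (m * k)" by (intro pow_carrier_mat) simp
    have "?C ^\<^sub>m t = map_mat complex_of_real (companion m k A ^\<^sub>m t)"
      by (rule of_real_hom.mat_hom_pow[OF companion_carrier, symmetric])
    then show ?thesis using less carrier_matD[OF t] by (simp add: impulse_def)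
  qed
  ultimately have "summable (\<lambda>t. \<bar>impulse m k A (t + i div m) i c\<bar>)" by simp
  then show ?thesis by (rule summable_iff_shift[THEN iffD1])
qed

section \<open>Toeplitz entries and the matrix form of the Yule-Walker system\<close>

text \<open>Free of the order, so orders \<open>k\<close> and \<open>k - 1\<close> share it and the
  shift property needs no index bounds.\<close>

definition toeplitz_entry :: "nat \<Rightarrow> (nat \<Rightarrow> real mat) \<Rightarrow> nat \<Rightarrow> nat \<Rightarrow> real" where
  "toeplitz_entry m U i j =
     (if i div m \<le> j div m then U (j div m - i div m)
      else transpose_mat (U (i div m - j div m))) $$ (i mod m, j mod m)"

lemma block_toeplitz_index:
  assumes "i < m * (t + 1)" "j < m * (t + 1)"
  shows "block_toeplitz m t U $$ (i, j) = toeplitz_entry m U i j"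
  using assms by (simp add: block_toeplitz_def toeplitz_entry_def)

lemma block_toeplitz_carrier [simp]:
  "block_toeplitz m t U \<in> carrier_mat (m * (t + 1)) (m * (t + 1))"
  by (simp add: block_toeplitz_def)

lemma toeplitz_entry_shift:
  assumes "0 < m"
  shows "toeplitz_entry m U (i + m) (j + m) = toeplitz_entry m U i j"
  using assms by (simp add: toeplitz_entry_def)

text \<open>\<open>block_row m k U\<close> is the top block row of the Toeplitz matrix without its
  first block, hence the offset \<open>j + m\<close>. Definiteness passes to the leading part of
  order \<open>k - 1\<close>, so the inverse can be cleared.\<close>

lemma yule_walker_iff:
  assumes m: "0 < m" and k: "0 < k"
    and pd: "pos_def_mat (m * (k + 1)) (block_toeplitz m k U)"
  shows "block_row m k A = block_row m k U * the (mat_inverse (block_toeplitz m (k - 1) U)) \<longleftrightarrow>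
    (\<forall>a<m. \<forall>j<m * k. (\<Sum>i<m * k. block_row m k A $$ (a, i) * toeplitz_entry m U i j) =
      toeplitz_entry m U a (j + m))"
proof -
  let ?M = "block_toeplitz m (k - 1) U"
  have M: "?M \<in> carrier_mat (m * k) (m * k)" using block_toeplitz_carrier[of m "k - 1" U] k by simp
  have M_index: "?M $$ (i, j) = toeplitz_entry m U i j" if "i < m * k" "j < m * k" for i j
    using that k by (intro block_toeplitz_index) simp_all
  have "pos_def_mat (m * k + m) (block_toeplitz m k U)" using pd by (simp add: add.commute)
  then have pdM: "pos_def_mat (m * k) ?M"
    by (rule pos_def_mat_leading[OF _ M]) (simp add: M_index[unfolded One_nat_def] block_toeplitz_index)
  have row: "block_row m k B \<in> carrier_mat m (m * k)" for B by (simp add: block_row_def)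
  have "block_row m k A * ?M = block_row m k U \<longleftrightarrow>
      (\<forall>a<m. \<forall>j<m * k. (block_row m k A * ?M) $$ (a, j) = block_row m k U $$ (a, j))"
    using carrier_matD[OF M] carrier_matD[OF row] by (auto simp: mat_eq_iff)
  also have "\<dots> \<longleftrightarrow> (\<forall>a<m. \<forall>j<m * k. (\<Sum>i<m * k. block_row m k A $$ (a, i) * toeplitz_entry m U i j) =
      toeplitz_entry m U a (j + m))"
  proof -
    have "(block_row m k A * ?M) $$ (a, j) =
        (\<Sum>i<m * k. block_row m k A $$ (a, i) * toeplitz_entry m U i j)"
      if "a < m" "j < m * k" for a j
      using that carrier_matD[OF M] carrier_matD[OF row]
      by (simp add: scalar_prod_def atLeast0LessThan M_index[unfolded One_nat_def])
    moreover have "block_row m k U $$ (a, j) = toeplitz_entry m U a (j + m)"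
      if "a < m" "j < m * k" for a j
      using that m by (simp add: block_row_index toeplitz_entry_def)
    ultimately show ?thesis by simp
  qed
  finally show ?thesis by (simp only: pos_def_mat_inverse[OF pdM row row])
qed

section \<open>The Horner sequence of a left null vector\<close>

lemma root_left_null_sequence:
  assumes m: "0 < m" and "det (matpoly_eval m k A z) = 0"
  obtains x :: "nat \<Rightarrow> complex"
  where "\<And>i. i < m * k \<Longrightarrow>
      x (i + m) = z * x i - (\<Sum>a<m. x a * complex_of_real (block_row m k A $$ (a, i)))"
    and "\<And>i. m * k \<le> i \<Longrightarrow> i < m * k + m \<Longrightarrow> x i = 0"
    and "\<exists>a<m. x a \<noteq> 0"
proof -
  let ?P = "transpose_mat (matpoly_eval m k A z)"
  have P: "?P \<in> carrier_mat m m" by simp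
  have "det ?P = 0" using assms(2) by (simp add: det_transpose[of _ m])
  then obtain w where w: "w \<in> carrier_vec m" "w \<noteq> 0\<^sub>v m" "?P *\<^sub>v w = 0\<^sub>v m"
    using det_0_iff_vec_prod_zero[OF P] by blast
  define s where "s l b = (\<Sum>a<m. w $ a * complex_of_real (A (Suc l) $$ (a, b)))" for l b
  \<comment> \<open>Closed form of the Horner scheme: \<open>X I\<close> is
    \<open>z^I w - z^(I-1) w A_1 - ... - w A_I\<close>, which at \<open>I = k\<close> is
    \<open>w A(z)\<close>.\<close>
  define X where "X I b = z ^ I * w $ b - (\<Sum>l<I. z ^ (I - Suc l) * s l b)" for I b
  define x where "x i = X (i div m) (i mod m)" for i
  have X_Suc: "X (Suc I) b = z * X I b - s I b" for I b
  proof -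
    have "z ^ (I - l) * s l b = z * (z ^ (I - Suc l) * s l b)" if "l < I" for l
    proof -
      have "I - l = Suc (I - Suc l)" using that by simp
      then show ?thesis by (simp only: power_Suc mult.assoc)
    qed
    then have "(\<Sum>l<I. z ^ (I - l) * s l b) = z * (\<Sum>l<I. z ^ (I - Suc l) * s l b)"
      unfolding sum_distrib_left by (intro sum.cong refl) simp_all
    then show ?thesis by (simp add: X_def right_diff_distrib mult.assoc)
  qed
  have X_top: "X k b = 0" if b: "b < m" for b
  proof -
    have "(?P *\<^sub>v w) $ b = (\<Sum>a<m. matpoly_eval m k A z $$ (a, b) * w $ a)"
      using b w(1) carrier_matD[OF matpoly_eval_carrier[of m k A z]]
      by (simp add: scalar_prod_def atLeast0LessThan)
    also have "\<dots> = (\<Sum>a<m. (if a = b then z ^ k * w $ b else 0) -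
        (\<Sum>l<k. z ^ (k - Suc l) * (w $ a * complex_of_real (A (Suc l) $$ (a, b)))))"
      using b by (intro sum.cong refl)
        (auto simp: matpoly_eval_index left_diff_distrib right_diff_distrib sum_distrib_left mult_ac)
    also have "\<dots> = X k b"
      using b unfolding X_def s_def sum_subtractf sum_distrib_left
      by (subst (2) sum.swap) simp
    finally show ?thesis using b by (simp add: w(3))
  qed
  have x_less: "x a = w $ a" if "a < m" for a
    using that by (simp add: x_def X_def)
  show ?thesis
  proof (rule that)
    show "x (i + m) = z * x i - (\<Sum>a<m. x a * complex_of_real (block_row m k A $$ (a, i)))"
      if "i < m * k" for i
      using that m by (simp add: x_def[of "i + m"] x_def[of i] X_Suc s_def x_less block_row_index)
    show "x i = 0" if "m * k \<le> i" "i < m * k + m" for i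
    proof -
      have "i div m = k" using that m by (intro div_nat_eqI) (simp_all add: mult.commute)
      then show ?thesis using m by (simp add: x_def X_top)
    qed
    show "\<exists>a<m. x a \<noteq> 0"
    proof (rule ccontr)
      assume "\<not> ?thesis"
      then have "w = 0\<^sub>v m" using w(1) by (intro eq_vecI) (auto simp: x_less)
      then show False using w(2) by simp
    qed
  qed
qed

section \<open>Equivalence of stability and the Toeplitz representation\<close>

theorem theorem4p1:
  fixes m k :: nat and A :: "nat \<Rightarrow> real mat"
  assumes "1 \<le> m" and "1 \<le> k"
    and "\<forall>l \<in> {1..k}. A l \<in> carrier_mat m m"
  shows "schur_stable m k A \<longleftrightarrow>
    (\<exists>U :: nat \<Rightarrow> real mat.
       (\<forall>l \<in> {0..k}. U l \<in> carrier_mat m m) \<and>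
       transpose_mat (U 0) = U 0 \<and>
       pos_def_mat (m * (k + 1)) (block_toeplitz m k U) \<and>
       block_row m k A =
         block_row m k U * the (mat_inverse (block_toeplitz m (k - 1) U)))"
    (is "_ \<longleftrightarrow> (\<exists>U. ?toeplitz U)")
proof
  have m: "0 < m" and k: "0 < k" using assms by simp_all
  assume stable: "schur_stable m k A"
  obtain G :: "nat \<Rightarrow> nat \<Rightarrow> real"
    where G_sym: "\<And>i j. G i j = G j i"
      and G_shift: "\<And>i j. G (i + m) (j + m) = G i j"
      and G_rec: "\<And>a j. a < m \<Longrightarrow>
        (\<Sum>i<m * k. block_row m k A $$ (a, i) * G i j) = G a (j + m)"
      and G_pos: "\<And>N (v :: nat \<Rightarrow> real). \<exists>i<N. v i \<noteq> 0 \<Longrightarrow> 0 < (\<Sum>i<N. \<Sum>j<N. v i * G i j * v j)"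
  proof (rule yule_walker_solution[OF m, where F = "impulse m k A" and n = "m * k"
          and \<alpha> = "\<lambda>a i. block_row m k A $$ (a, i)",
          OF impulse_0[OF _ k] impulse_shift[OF m] impulse_rec[OF _ _ k]
            impulse_summable[OF stable _ k]], goal_cases)
    case (5 G)
    show ?case by (rule that) (fact 5)+
  qed
  have G_shifts: "G (i + l * m) (j + l * m) = G i j" for i j l
    by (induction l) (use G_shift in \<open>simp_all add: add.assoc[symmetric] add.commute[of m]\<close>)
  \<comment> \<open>The blocks are read off the first block row of \<open>G\<close>; its shift
    invariance and symmetry determine all other entries.\<close>
  define U where "U h = mat m m (\<lambda>(a, b). G a (h * m + b))" for h
  have U_index: "U (j div m - i div m) $$ (i mod m, j mod m) = G i j"
    if "i div m \<le> j div m" for i j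
  proof -
    have "(j div m - i div m) * m + j mod m + (i div m) * m = (j div m - i div m + i div m) * m + j mod m"
      by (simp only: add_mult_distrib)
    also have "\<dots> = j" using that by simp
    finally have "G i j = G (i mod m + (i div m) * m) ((j div m - i div m) * m + j mod m + (i div m) * m)"
      by simp
    also have "\<dots> = G (i mod m) ((j div m - i div m) * m + j mod m)" by (rule G_shifts)
    finally show ?thesis using m by (simp add: U_def)
  qed
  have U_entry: "toeplitz_entry m U i j = G i j" for i j
  proof (cases "i div m \<le> j div m")
    case True
    then show ?thesis by (simp add: toeplitz_entry_def U_index)
  next
    case False
    then have "toeplitz_entry m U i j = U (i div m - j div m) $$ (j mod m, i mod m)"
      using m by (simp add: toeplitz_entry_def U_def)
    then show ?thesis using False U_index[of j i] by (simp add: G_sym[of i])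
  qed
  have pd: "pos_def_mat (m * (k + 1)) (block_toeplitz m k U)"
    unfolding pos_def_mat_iff
  proof (intro conjI allI impI)
    fix v :: "nat \<Rightarrow> real"
    assume "\<exists>i<m * (k + 1). v i \<noteq> 0"
    then have "0 < (\<Sum>i<m * (k + 1). \<Sum>j<m * (k + 1). v i * G i j * v j)" by (rule G_pos)
    also have "\<dots> = (\<Sum>i<m * (k + 1). \<Sum>j<m * (k + 1). v i * block_toeplitz m k U $$ (i, j) * v j)"
      by (intro sum.cong refl) (simp add: block_toeplitz_index U_entry)
    finally show "0 < (\<Sum>i<m * (k + 1). \<Sum>j<m * (k + 1). v i * block_toeplitz m k U $$ (i, j) * v j)" .
  next
    fix i j assume "i < m * (k + 1)" "j < m * (k + 1)"
    then show "block_toeplitz m k U $$ (i, j) = block_toeplitz m k U $$ (j, i)"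
      by (simp only: block_toeplitz_index U_entry G_sym[of i])
  qed (rule block_toeplitz_carrier)
  have "transpose_mat (U 0) = U 0"
    using G_sym by (auto simp: U_def)
  moreover have "block_row m k A =
      block_row m k U * the (mat_inverse (block_toeplitz m (k - 1) U))"
    unfolding yule_walker_iff[OF m k pd] U_entry by (simp add: G_rec)
  ultimately have "?toeplitz U" using pd by (simp add: U_def)
  then show "\<exists>U. ?toeplitz U" by blast
next
  have m: "0 < m" and k: "0 < k" using assms by simp_all
  assume "\<exists>U. ?toeplitz U"
  then obtain U where pd: "pos_def_mat (m * (k + 1)) (block_toeplitz m k U)"
    and eq: "block_row m k A =
      block_row m k U * the (mat_inverse (block_toeplitz m (k - 1) U))"
    by blast
  have N: "m * (k + 1) = m * k + m" by simp
  show "schur_stable m k A"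
    unfolding schur_stable_def
  proof (intro allI impI)
    fix z assume "det (matpoly_eval m k A z) = 0"
    \<comment> \<open>The root yields the Horner sequence to which the Toeplitz norm argument
      applies.\<close>
    then obtain x :: "nat \<Rightarrow> complex"
      where x: "\<And>i. i < m * k \<Longrightarrow>
          x (i + m) = z * x i - (\<Sum>a<m. x a * complex_of_real (block_row m k A $$ (a, i)))"
        "\<And>i. m * k \<le> i \<Longrightarrow> i < m * k + m \<Longrightarrow> x i = 0"
        "\<exists>a<m. x a \<noteq> 0"
    proof (rule root_left_null_sequence[OF m], goal_cases)
      case (1 x)
      show ?case by (rule that) (fact 1)+
    qed
    show "cmod z < 1"
    proof (rule yule_walker_root_bound[where T = "toeplitz_entry m U" and n = "m * k" and m = m
          and x = x and \<alpha> = "\<lambda>a i. block_row m k A $$ (a, i)"])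
      note pd' = pd[unfolded pos_def_mat_iff]
      fix i j assume "i < m * k + m" "j < m * k + m"
      then have ij: "i < m * (k + 1)" "j < m * (k + 1)" by simp_all
      then have "block_toeplitz m k U $$ (i, j) = block_toeplitz m k U $$ (j, i)"
        using pd' by blast
      then show "toeplitz_entry m U i j = toeplitz_entry m U j i"
        using ij by (simp only: block_toeplitz_index)
    next
      fix v :: "nat \<Rightarrow> real" assume "\<exists>i<m * k + m. v i \<noteq> 0"
      then have "0 < (\<Sum>i<m * (k + 1). \<Sum>j<m * (k + 1). v i * block_toeplitz m k U $$ (i, j) * v j)"
        using pd unfolding pos_def_mat_iff N by blast
      also have "\<dots> = (\<Sum>i<m * (k + 1). \<Sum>j<m * (k + 1). v i * toeplitz_entry m U i j * v j)"
        by (intro sum.cong refl) (simp add: block_toeplitz_index)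
      finally show "0 < (\<Sum>i<m * k + m. \<Sum>j<m * k + m. v i * toeplitz_entry m U i j * v j)"
        by (simp only: N)
    next
      show "(\<Sum>i<m * k. block_row m k A $$ (a, i) * toeplitz_entry m U i j) =
          toeplitz_entry m U a (j + m)" if "a < m" "j < m * k" for a j
        using eq that unfolding yule_walker_iff[OF m k pd] by blast
    next
      show "toeplitz_entry m U (i + m) (j + m) = toeplitz_entry m U i j" for i j
        by (rule toeplitz_entry_shift[OF m])
    qed (fact x)+
  qed
qed

end
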